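(* For all $n\ge2$ and $r\in\{1,2,n\}$, $$|S_{n,r}(3412,3421)|=\mathbb{S}_{n-2};$$ and for all $n\ge4$ and $2<r<n$, $$|S_{n,r}(3412,3421)|=\mathbb{S}_{r-2}\,\mathbb{S}_{n-r},$$ where $\mathbb{S}_m$ is the $m$th large Schr\"oder number.
   Context: $S_n$ is the set of permutations of $\{1,\ldots,n\}$ written as sequences $(\tau(1),\ldots,\tau(n))$. A permutation $\tau\in S_n$ contains $\sigma\in S_k$ as a pattern if there are indices $1\le i_1<\cdots<i_k\le n$ such that for all $1\le a<b\le k$, $\tau(i_a)<\tau(i_b)$ if and only if $\sigma(a)<\sigma(b)$; otherwise $\tau$ avoids $\sigma$. $S_{n,r}(\sigma_1,\ldots,\sigma_m)$ is the set of $\tau\in S_n$ with $\tau(1)=r$ that avoid all of $\sigma_1,\ldots,\sigma_m$. The large (big) Schr\"oder number $\mathbb{S}_m$, $m\ge0$, is the number of lattice paths from $(0,0)$ to $(m,m)$ with steps $(1,0),(0,1),(1,1)$ that never go above the line $y=x$; the sequence begins $\mathbb{S}_0=1,\ \mathbb{S}_1=2,\ \mathbb{S}_2=6,\ \mathbb{S}_3=22,\ \mathbb{S}_4=90,\ldots$ (OEIS A006318). *)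

theory Defs
  imports "HOL-Combinatorics.Multiset_Permutations" "HOL-Library.Product_Plus"
begin

text \<open>
  Permutations of \<open>{1, \<dots>, n}\<close> are lists in one-line notation, i.e. the elements of
  \<open>permutations_of_set {1..n}\<close>. The values lie in \<open>{1..n}\<close>, but positions are list positions and
  hence start at 0: the entry \<open>\<tau>(i)\<close> is \<open>\<tau> ! (i - 1)\<close>.
\<close>

definition contains_pattern :: "nat list \<Rightarrow> nat list \<Rightarrow> bool" where
  "contains_pattern \<tau> \<sigma> \<longleftrightarrow>
     (\<exists>i :: nat \<Rightarrow> nat. strict_mono_on {..<length \<sigma>} i \<and> i ` {..<length \<sigma>} \<subseteq> {..<length \<tau>} \<and>
        (\<forall>a b. a < b \<and> b < length \<sigma> \<longrightarrow> (\<tau> ! i a < \<tau> ! i b \<longleftrightarrow> \<sigma> ! a < \<sigma> ! b)))"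

definition avoids_pattern :: "nat list \<Rightarrow> nat list \<Rightarrow> bool" where
  "avoids_pattern \<tau> \<sigma> \<longleftrightarrow> \<not> contains_pattern \<tau> \<sigma>"

definition avoiders_from :: "nat \<Rightarrow> nat \<Rightarrow> nat list set \<Rightarrow> nat list set" where
  "avoiders_from n r P =
     {\<tau> \<in> permutations_of_set {1..n}. \<tau> ! 0 = r \<and> (\<forall>\<sigma>\<in>P. avoids_pattern \<tau> \<sigma>)}"

text \<open>
  A lattice path starting at \<open>(0,0)\<close> is the list of its steps, so the vertex reached after \<open>k\<close> steps
  is \<open>sum_list (take k p)\<close>. As every step is a straight segment, the path stays weakly below the
  line \<open>y = x\<close> iff all its vertices do.
\<close>

definition schroeder_paths :: "nat \<Rightarrow> (nat \<times> nat) list set" where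
  "schroeder_paths m =
     {p. set p \<subseteq> {(1, 0), (0, 1), (1, 1)} \<and> sum_list p = (m, m) \<and>
         (\<forall>k\<le>length p. snd (sum_list (take k p)) \<le> fst (sum_list (take k p)))}"

definition large_schroeder :: "nat \<Rightarrow> nat" where
  "large_schroeder m = card (schroeder_paths m)"

end

theory Submission
  imports Defs "HOL-Library.Sublist" "HOL-Library.Infinite_Set"
begin

text \<open>
  Let \<open>a m\<close> be the number of permutations of an \<open>m\<close>-element set avoiding both patterns. An entry
  smaller than a first entry \<open>r\<close> that is not the last such entry must precede all entries larger
  than \<open>r\<close>, for otherwise \<open>r\<close> plays the role of 3. Hence the remaining entries are the smaller
  ones except the last, followed by a shuffle of the larger entries with the last smaller entry
  \<open>u\<close>. There \<open>u\<close> only acts as a minimum and can be replaced by \<open>r\<close>, so that for \<open>r \<ge> 2\<close> the number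
  of avoiders starting with \<open>r\<close> is \<open>a (r - 1) * a (n - r + 1)\<close>. Summing over \<open>r\<close> gives for \<open>a (k + 1)\<close>
  the first-return recurrence of the large Schroeder numbers.
\<close>

section \<open>The Schroeder recurrence\<close>

text \<open>Here \<open>h\<close> is the excess \<open>x - y\<close> at the start of the path, which must end on the diagonal.\<close>

fun descends :: "nat \<Rightarrow> (nat \<times> nat) list \<Rightarrow> bool" where
  "descends h [] \<longleftrightarrow> h = 0"
| "descends h (s # p) \<longleftrightarrow> s = (1, 0) \<and> descends (Suc h) p \<or> s = (1, 1) \<and> descends h p \<or>
     s = (0, 1) \<and> h > 0 \<and> descends (h - 1) p"

text \<open>Links the recursive predicate, suited to induction on the first step, with the condition
  on all vertices. The excess has to vary in the induction because every step \<open>(1, 0)\<close>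
  or \<open>(0, 1)\<close> changes it.\<close>

lemma descends_iff:
  "descends h p \<longleftrightarrow> set p \<subseteq> {(1, 0), (0, 1), (1, 1)} \<and> snd (sum_list p) = fst (sum_list p) + h \<and>
     (\<forall>k\<le>length p. snd (sum_list (take k p)) \<le> fst (sum_list (take k p)) + h)"
proof (induction p arbitrary: h)
  case Nil
  show ?case by auto
next
  case (Cons s p)
  have all_le_Suc: "(\<forall>k\<le>Suc n. P k) \<longleftrightarrow> P 0 \<and> (\<forall>k\<le>n. P (Suc k))" for P :: "nat \<Rightarrow> bool" and n
    by (metis Suc_le_mono le0 not0_implies_Suc)
  have shift: "Suc y \<le> x + h \<longleftrightarrow> y \<le> x + (h - 1)" if "h > 0" for x y
    using that by arith
  \<comment> \<open>The instance \<open>k = 0\<close> is the vertex directly after a first step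
    \<open>(0, 1)\<close>; it can be legal only if the excess was positive before.\<close>
  have pos: "h > 0" if "\<forall>k\<le>length p. Suc (snd (sum_list (take k p))) \<le> fst (sum_list (take k p)) + h"
    using spec[OF that, of 0] by simp
  show ?case
    unfolding descends.simps Cons.IH list.size add_0_right add_Suc_right all_le_Suc
    apply (cases "s = (1,0)")
     apply simp
    apply (cases "s = (1,1)")
     apply simp
    apply (cases "s = (0,1)")
     apply (cases "h > 0")
      apply (auto simp: shift)[1]
    using pos
     apply force
    apply simp
    done
qed

lemma schroeder_paths_iff:
  "p \<in> schroeder_paths m \<longleftrightarrow> descends 0 p \<and> fst (sum_list p) = m"
  unfolding schroeder_paths_def descends_iff by (auto simp: prod_eq_iff)

text \<open>Started \<open>g\<close> higher, \<open>p\<close> keeps its excess at or above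
  \<open>g\<close> and ends exactly at \<open>g\<close>, where \<open>q\<close> takes over.\<close>

lemma descends_append: "descends h p \<Longrightarrow> descends (h + g) (p @ q) \<longleftrightarrow> descends g q"
proof (induction p arbitrary: h)
  case (Cons s p)
  then show ?case
    using Cons.IH[of "Suc h"] Cons.IH[of h] Cons.IH[of "h - 1"] by (cases h) auto
qed simp

text \<open>The cut is made at the first step that takes the excess below its starting value
  \<open>Suc h\<close>. Up to there the path never drops below that value, so measured from it
  \<open>q\<close> starts and ends at 0.\<close>

lemma descends_first_return:
  assumes "descends (Suc h) p"
  obtains q q' where "p = q @ (0, 1) # q'" "descends 0 q" "descends h q'"
proof -
  have "\<exists>q q'. p = q @ (0, 1) # q' \<and> descends 0 q \<and> descends h q'"
    using assms
  proof (induction "length p" arbitrary: p h rule: less_induct)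
    case less
    show ?case
    proof (cases p)
      case Nil
      then show ?thesis using less.prems by simp
    next
      case (Cons s p')
      then consider "s = (1, 0)" "descends (Suc (Suc h)) p'" | "s = (1, 1)" "descends (Suc h) p'"
        | "s = (0, 1)" "descends h p'"
        using less.prems by auto
      then show ?thesis
      proof cases
        case 1
        \<comment> \<open>The excess is now two above \<open>h\<close>, so two drops are split off,
          one after the other. The second application concerns the remainder \<open>r\<close>, which
          is why the induction is on the length.\<close>
        obtain q1 r where r: "p' = q1 @ (0, 1) # r" "descends 0 q1" "descends (Suc h) r"
          using less.hyps[of p' "Suc h"] 1 Cons by auto
        obtain q2 q3 where q: "r = q2 @ (0, 1) # q3" "descends 0 q2" "descends h q3"
          using less.hyps[of r h] r Cons by auto
        \<comment> \<open>Seen from the level before the step \<open>(1, 0)\<close>, this stretch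
          leads from excess 1 back to 0, so \<open>(1, 0)\<close> in front of it gives the piece to
          be cut off.\<close>
        have "descends 1 (q1 @ (0, 1) # q2)"
          using descends_append[OF r(2), of 1 "(0, 1) # q2"] q by simp
        then show ?thesis
          using 1 Cons r q by (intro exI[of _ "(1, 0) # q1 @ (0, 1) # q2"] exI[of _ q3]) simp
      next
        case 2
        obtain q q' where "p' = q @ (0, 1) # q'" "descends 0 q" "descends h q'"
          using less.hyps[of p' h] 2 Cons by auto
        then show ?thesis
          using 2 Cons by (intro exI[of _ "(1, 1) # q"] exI[of _ q']) simp
      next
        case 3
        then show ?thesis
          using Cons by (intro exI[of _ "[]"] exI[of _ p']) simp
      qed
    qed
  qed
  then show ?thesis using that by blast
qed

text \<open>If the cuts differed, the shorter piece followed by \<open>(0, 1)\<close> would be an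
  initial part of the longer one, which would then cross the diagonal.\<close>

lemma first_return_unique:
  assumes "descends 0 q" "descends 0 r" "q @ (0, 1) # q' = r @ (0, 1) # r'"
  shows "q = r \<and> q' = r'"
proof -
  have no_ext: "\<not> descends 0 (p @ (0, 1) # us)" if "descends 0 p" for p us
    using descends_append[OF that, of 0 "(0, 1) # us"] by simp
  show ?thesis
  proof (rule ccontr)
    assume neq: "\<not> ?thesis"
    from assms(3) consider us where "q = r @ us" "us @ (0, 1) # q' = (0, 1) # r'"
      | us where "q @ us = r" "(0, 1) # q' = us @ (0, 1) # r'"
      unfolding append_eq_append_conv2 by auto
    then show False
    proof cases
      case 1
      then show False using neq no_ext[of r] assms by (cases us) auto
    next
      case 2
      then show False using neq no_ext[of q] assms by (cases us) auto
    qed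
  qed
qed

section \<open>Decomposition of Schroeder paths at the first return\<close>

lemma schroeder_paths_0: "schroeder_paths 0 = {[]}"
proof -
  have "p = []" if "descends 0 p" "fst (sum_list p) = 0" for p
    using that by (cases p) auto
  then show ?thesis by (auto simp: schroeder_paths_iff)
qed

lemma schroeder_paths_Suc:
  "schroeder_paths (Suc n) = (#) (1, 1) ` schroeder_paths n \<union>
     (\<lambda>(q, q'). (1, 0) # q @ (0, 1) # q') `
       (\<Union>i\<le>n. schroeder_paths i \<times> schroeder_paths (n - i))" (is "?L = ?R")
proof
  show "?L \<subseteq> ?R"
  proof
    fix p assume p: "p \<in> ?L"
    then obtain s p' where s: "p = s # p'"
      by (cases p) (auto simp: schroeder_paths_iff)
    with p consider "s = (1, 1)" "descends 0 p'" "fst (sum_list p') = n"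
      | "s = (1, 0)" "descends (Suc 0) p'" "fst (sum_list p') = n"
      by (auto simp: schroeder_paths_iff)
    then show "p \<in> ?R"
    proof cases
      case 1
      then show ?thesis using s by (auto simp: schroeder_paths_iff)
    next
      case 2
      then obtain q q' where q: "p' = q @ (0, 1) # q'" "descends 0 q" "descends 0 q'"
        using descends_first_return by blast
      \<comment> \<open>The index of the union is the horizontal extent of the first excursion
        without its initial step.\<close>
      have "(q, q') \<in> (\<Union>i\<le>n. schroeder_paths i \<times> schroeder_paths (n - i))"
        using q 2 by (intro UN_I[of "fst (sum_list q)"]) (auto simp: schroeder_paths_iff)
      then show ?thesis using s 2 q by (intro UnI2 image_eqI[of _ _ "(q, q')"]) auto
    qed
  qed
  have "descends (Suc 0) (q @ (0, 1) # q')" if "descends 0 q" "descends 0 q'" for q q'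
    using descends_append[OF that(1), of "Suc 0" "(0, 1) # q'"] that by simp
  then show "?R \<subseteq> ?L"
    by (auto simp: schroeder_paths_iff)
qed

lemma finite_schroeder_paths: "finite (schroeder_paths m)"
proof (induction m rule: less_induct)
  case (less m)
  then show ?case
    by (cases m) (auto simp: schroeder_paths_0 schroeder_paths_Suc intro!: finite_imageI)
qed

lemma large_schroeder_0: "large_schroeder 0 = 1"
  by (simp add: large_schroeder_def schroeder_paths_0)

text \<open>The two kinds of path differ in their first step, and the first return determines the
  pair \<open>(q, q')\<close>, so cardinalities add and multiply.\<close>

lemma large_schroeder_Suc:
  "large_schroeder (Suc n) =
     large_schroeder n + (\<Sum>i\<le>n. large_schroeder i * large_schroeder (n - i))"
proof -
  let ?f = "\<lambda>(q, q'). (1, 0) # q @ (0, 1) # q' :: (nat \<times> nat) list"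
  let ?U = "\<Union>i\<le>n. schroeder_paths i \<times> schroeder_paths (n - i)"
  have inj: "inj_on ?f ?U"
  proof (rule inj_onI)
    fix x y assume "x \<in> ?U" "y \<in> ?U" and eq: "?f x = ?f y"
    then have "descends 0 (fst x)" "descends 0 (fst y)"
      by (auto simp: schroeder_paths_iff)
    from first_return_unique[OF this, of "snd x" "snd y"] eq show "x = y"
      by (simp add: case_prod_beta prod_eq_iff)
  qed
  have "card ?U = (\<Sum>i\<le>n. card (schroeder_paths i \<times> schroeder_paths (n - i)))"
    by (intro card_UN_disjoint) (auto simp: finite_schroeder_paths schroeder_paths_iff)
  then have "card (?f ` ?U) = (\<Sum>i\<le>n. large_schroeder i * large_schroeder (n - i))"
    using inj by (simp add: card_image card_cartesian_product large_schroeder_def)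
  moreover have "card ((#) (1, 1) ` schroeder_paths n) = large_schroeder n"
    by (simp add: card_image large_schroeder_def)
  moreover have "(#) (1, 1) ` schroeder_paths n \<inter> ?f ` ?U = {}"
    by auto
  ultimately show ?thesis
    unfolding large_schroeder_def[of "Suc n"] schroeder_paths_Suc
    by (subst card_Un_disjoint) (auto simp: finite_schroeder_paths intro!: finite_imageI)
qed

section \<open>Pattern containment through subsequences\<close>

text \<open>Lets the index functions in the definition of containment be traded for subsequences,
  which behave well under append, filter and map.\<close>

lemma subseq_iff_embedding:
  "subseq ys xs \<longleftrightarrow> (\<exists>i :: nat \<Rightarrow> nat. strict_mono_on {..<length ys} i \<and>
     i ` {..<length ys} \<subseteq> {..<length xs} \<and> (\<forall>a<length ys. ys ! a = xs ! i a))"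
proof
  show "\<exists>i :: nat \<Rightarrow> nat. strict_mono_on {..<length ys} i \<and>
     i ` {..<length ys} \<subseteq> {..<length xs} \<and> (\<forall>a<length ys. ys ! a = xs ! i a)"
    if "subseq ys xs" using that
  proof (induction rule: list_emb.induct)
    case (list_emb_Nil ys)
    show ?case by (auto simp: strict_mono_on_def)
  next
    case (list_emb_Cons xs ys y)
    then obtain i where "strict_mono_on {..<length xs} i" "i ` {..<length xs} \<subseteq> {..<length ys}"
      "\<forall>a<length xs. xs ! a = ys ! i a" by blast
    then show ?case
      by (intro exI[of _ "\<lambda>a. Suc (i a)"]) (auto simp: strict_mono_on_def)
  next
    case (list_emb_Cons2 x y xs ys)
    then obtain i where "strict_mono_on {..<length xs} i" "\<forall>a<length xs. i a < length ys"
      "\<forall>a<length xs. xs ! a = ys ! i a" by (auto simp: image_subset_iff)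
    then show ?case
      using list_emb_Cons2(1)
      by (intro exI[of _ "\<lambda>a. case a of 0 \<Rightarrow> 0 | Suc a \<Rightarrow> Suc (i a)"])
        (auto simp: strict_mono_on_def nth_Cons split: nat.splits)
  qed
next
  assume "\<exists>i :: nat \<Rightarrow> nat. strict_mono_on {..<length ys} i \<and>
     i ` {..<length ys} \<subseteq> {..<length xs} \<and> (\<forall>a<length ys. ys ! a = xs ! i a)"
  then obtain i :: "nat \<Rightarrow> nat" where i: "strict_mono_on {..<length ys} i"
    "i ` {..<length ys} \<subseteq> {..<length xs}" "\<forall>a<length ys. ys ! a = xs ! i a" by blast
  \<comment> \<open>The chosen positions form an increasing list, hence a subsequence of the list of
    all positions; reading off the entries of \<open>xs\<close> preserves this.\<close>
  have "sorted_wrt (<) (map i [0..<length ys])"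
    using i(1) by (auto simp: sorted_wrt_iff_nth_less strict_mono_on_def)
  then have "subseq (map i [0..<length ys]) [0..<length xs]"
    using i(2) by (intro sorted_subset_imp_subseq) (auto simp: lessThan_atLeast0)
  then have "subseq (map ((!) xs) (map i [0..<length ys])) (map ((!) xs) [0..<length xs])"
    by (rule subseq_map)
  moreover have "map ((!) xs) (map i [0..<length ys]) = ys"
    using i(3) by (auto intro: nth_equalityI)
  ultimately show "subseq ys xs" by (simp add: map_nth)
qed

lemma contains_pattern_iff:
  "contains_pattern \<tau> \<sigma> \<longleftrightarrow> (\<exists>ys. subseq ys \<tau> \<and> length ys = length \<sigma> \<and>
     (\<forall>a b. a < b \<and> b < length \<sigma> \<longrightarrow> (ys ! a < ys ! b \<longleftrightarrow> \<sigma> ! a < \<sigma> ! b)))" (is "_ \<longleftrightarrow> ?R")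
proof
  assume "contains_pattern \<tau> \<sigma>"
  then obtain i :: "nat \<Rightarrow> nat" where
    "strict_mono_on {..<length \<sigma>} i" "i ` {..<length \<sigma>} \<subseteq> {..<length \<tau>}"
    "\<forall>a b. a < b \<and> b < length \<sigma> \<longrightarrow> (\<tau> ! i a < \<tau> ! i b \<longleftrightarrow> \<sigma> ! a < \<sigma> ! b)"
    unfolding contains_pattern_def by blast
  then show ?R
    by (intro exI[of _ "map (\<lambda>a. \<tau> ! i a) [0..<length \<sigma>]"]) (auto simp: subseq_iff_embedding)
next
  assume ?R
  then show "contains_pattern \<tau> \<sigma>"
    unfolding contains_pattern_def subseq_iff_embedding by (metis order.strict_trans)
qed

text \<open>The last two entries of 3412 and 3421 occur in both orders, so avoiding both patterns means
  that no two entries after a non-inversion \<open>a < b\<close> are smaller than \<open>a\<close>.\<close>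

definition good :: "nat list \<Rightarrow> bool" where
  "good xs \<longleftrightarrow> \<not> (\<exists>a b c d. subseq [a, b, c, d] xs \<and> c < a \<and> d < a \<and> a < b)"

lemma avoids_both_iff_good:
  assumes "distinct \<tau>"
  shows "(\<forall>\<sigma>\<in>{[3, 4, 1, 2], [3, 4, 2, 1]}. avoids_pattern \<tau> \<sigma>) \<longleftrightarrow> good \<tau>"
proof -
  have ex4: "(\<exists>ys. P ys \<and> length ys = 4 \<and> Q ys) \<longleftrightarrow>
      (\<exists>a b c d. P [a, b, c, d] \<and> Q [a, b, c, d])" for P Q :: "nat list \<Rightarrow> bool"
    by (auto simp: length_Suc_conv eval_nat_numeral)
  have all4: "(\<forall>a b. a < b \<and> b < (4::nat) \<longrightarrow> R a b) \<longleftrightarrow>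
      R 0 1 \<and> R 0 2 \<and> R 0 3 \<and> R 1 2 \<and> R 1 3 \<and> R 2 3" for R
    by (auto simp: less_Suc_eq eval_nat_numeral)
  have len: "length [3, 4, 1, 2 :: nat] = 4" "length [3, 4, 2, 1 :: nat] = 4"
    by simp_all
  have c1: "contains_pattern \<tau> [3, 4, 1, 2] \<longleftrightarrow> (\<exists>a b c d. subseq [a, b, c, d] \<tau> \<and>
      a < b \<and> \<not> a < c \<and> \<not> a < d \<and> \<not> b < c \<and> \<not> b < d \<and> c < d)"
    unfolding contains_pattern_iff len ex4 all4 by simp
  have c2: "contains_pattern \<tau> [3, 4, 2, 1] \<longleftrightarrow> (\<exists>a b c d. subseq [a, b, c, d] \<tau> \<and>
      a < b \<and> \<not> a < c \<and> \<not> a < d \<and> \<not> b < c \<and> \<not> b < d \<and> \<not> c < d)"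
    unfolding contains_pattern_iff len ex4 all4 by simp
  \<comment> \<open>Distinct entries turn each negated comparison into a strict reverse one. The
    comparison of \<open>c\<close> with \<open>d\<close> has disappeared, since the two patterns
    cover both of its outcomes.\<close>
  have "(a < b \<and> \<not> a < c \<and> \<not> a < d \<and> \<not> b < c \<and> \<not> b < d) \<longleftrightarrow> (c < a \<and> d < a \<and> a < b)"
    if "subseq [a, b, c, d] \<tau>" for a b c d
  proof -
    obtain N where "[a, b, c, d] = nths \<tau> N"
      using \<open>subseq [a, b, c, d] \<tau>\<close> by (auto simp: subseq_conv_nths)
    then have "distinct [a, b, c, d]" using assms by (metis distinct_nthsI)
    then show ?thesis by auto
  qed
  then show ?thesis
    unfolding avoids_pattern_def good_def ball_simps c1 c2 by blast
qed

section \<open>Counting by the first entry\<close>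

lemma good_subseq: "good ys" if "good xs" "subseq ys xs"
  using that unfolding good_def by (meson subseq_order.order_trans)

lemma set_mono_subseq: "subseq xs ys \<Longrightarrow> set xs \<subseteq> set ys"
  by (auto simp: subseq_conv_nths dest: in_set_nthsD)

lemma subseq_map_iff: "subseq ys (map f xs) \<longleftrightarrow> (\<exists>zs. subseq zs xs \<and> ys = map f zs)"
  by (auto simp: subseq_conv_nths nths_map)

text \<open>Only comparisons between entries enter \<open>good\<close>, and an increasing
  relabelling preserves them.\<close>

lemma good_map:
  assumes "strict_mono_on (set xs) f"
  shows "good (map f xs) \<longleftrightarrow> good xs"
proof -
  have less: "f x < f y \<longleftrightarrow> x < y" if "x \<in> set xs" "y \<in> set xs" for x y
    using strict_mono_on_less[OF assms that] .
  have mem: "a \<in> set xs \<and> b \<in> set xs \<and> c \<in> set xs \<and> d \<in> set xs"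
    if "subseq [a, b, c, d] xs" for a b c d
    using that set_mono_subseq by force
  show ?thesis
  proof
    assume f: "good (map f xs)"
    show "good xs"
      unfolding good_def
    proof (rule notI, elim exE conjE)
      fix a b c d assume *: "subseq [a, b, c, d] xs" "c < a" "d < a" "a < b"
      have "subseq [f a, f b, f c, f d] (map f xs)"
        using subseq_map[OF *(1), of f] by simp
      then show False using f mem[OF *(1)] *(2-) less unfolding good_def by blast
    qed
  next
    assume g: "good xs"
    show "good (map f xs)"
      unfolding good_def
    proof (rule notI, elim exE conjE)
      fix a b c d assume *: "subseq [a, b, c, d] (map f xs)" "c < a" "d < a" "a < b"
      then obtain a' b' c' d' where sub: "subseq [a', b', c', d'] xs"
        and eq: "a = f a'" "b = f b'" "c = f c'" "d = f d'"
        by (auto simp: subseq_map_iff Cons_eq_map_conv)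
      show False using g mem[OF sub] sub *(2-) less unfolding eq good_def by blast
    qed
  qed
qed

section \<open>Avoiders on an arbitrary set of values\<close>

definition good_perms :: "nat set \<Rightarrow> nat list set" where
  "good_perms A = {xs \<in> permutations_of_set A. good xs}"

text \<open>Standardization: the increasing bijection from an initial segment onto \<open>A\<close>
  relabels the avoiders, so only the size of \<open>A\<close> matters.\<close>

lemma card_good_perms:
  assumes "finite A"
  shows "card (good_perms A) = card (good_perms {..<card A})"
proof -
  obtain h where h: "bij_betw h {..<card A} A" "strict_mono_on {..<card A} h"
    using ex_bij_betw_strict_mono_card[OF assms] by blast
  have inj: "inj_on h {..<card A}" and img: "h ` {..<card A} = A"
    using h(1) by (auto simp: bij_betw_def)
  have "permutations_of_set A = map h ` permutations_of_set {..<card A}"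
    using permutations_of_set_image_inj[OF inj] img by simp
  moreover have "good (map h xs) \<longleftrightarrow> good xs" if "xs \<in> permutations_of_set {..<card A}" for xs
    using that h(2) by (intro good_map) (simp add: permutations_of_set_def)
  ultimately have "good_perms A = map h ` good_perms {..<card A}"
    unfolding good_perms_def by auto
  moreover have "inj_on (map h) (good_perms {..<card A})"
    using inj by (intro inj_onI) (auto simp: good_perms_def permutations_of_set_def intro: map_inj_on)
  ultimately show ?thesis by (simp add: card_image)
qed

definition good_tails :: "nat \<Rightarrow> nat set \<Rightarrow> nat list set" where
  "good_tails r A = {xs \<in> permutations_of_set A. good (r # xs)}"

text \<open>A forbidden subsequence that uses the new entry has it in first place, which requires a
  smaller entry later on.\<close>

lemma good_Cons_least:
  assumes "\<And>x. x \<in> set xs \<Longrightarrow> r \<le> x"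
  shows "good (r # xs) \<longleftrightarrow> good xs"
proof -
  have "\<not> subseq [a, b, c, d] (r # xs)" if "\<not> subseq [a, b, c, d] xs" "c < a" for a b c d
  proof
    assume *: "subseq [a, b, c, d] (r # xs)"
    then have "a = r" "subseq [b, c, d] xs"
      using that(1) by (auto split: if_splits)
    moreover from this have "c \<in> set xs"
      using set_mono_subseq by force
    ultimately show False using assms[of c] that(2) by simp
  qed
  then show ?thesis unfolding good_def by (meson list_emb_Cons)
qed

lemma good_tails_least:
  assumes "\<And>x. x \<in> A \<Longrightarrow> r \<le> x"
  shows "good_tails r A = good_perms A"
  using assms unfolding good_tails_def good_perms_def
  by (auto simp: good_Cons_least permutations_of_set_def)

section \<open>The product formula for a fixed first entry\<close>

lemma subseq_Cons_drop_prefix: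
  "subseq (x # xs) (ys @ zs) \<Longrightarrow> x \<notin> set ys \<Longrightarrow> subseq (x # xs) zs"
  by (induction ys) (auto split: if_splits)

text \<open>Both lists on the right are, up to order isomorphism, subsequences of the list on the
  left. Conversely, a forbidden subsequence is located by comparing its entries \<open>a\<close> and
  \<open>b\<close> with \<open>r\<close>: it must lie within one of the two parts.\<close>

lemma good_merge_iff:
  fixes r u :: nat
  assumes "\<forall>x\<in>set s. x < r" "u < r" "\<forall>x\<in>set t1 \<union> set t2. r < x"
  shows "good (r # s @ t1 @ u # t2) \<longleftrightarrow> good (s @ [u]) \<and> good (t1 @ r # t2)"
proof -
  have gt: "\<forall>x\<in>set t1. r < x" "\<forall>x\<in>set t2. r < x"
    using assms(3) by simp_all
  have nless: "\<forall>x\<in>set t1. \<not> x < r" "\<forall>x\<in>set t2. \<not> x < r"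
    using gt by (meson less_asym)+
  \<comment> \<open>Both \<open>r\<close> and \<open>u\<close> lie below all entries of
    \<open>t1\<close> and \<open>t2\<close>, so putting one in place of the other is an increasing
    relabelling.\<close>
  define f where "f x = (if x = r then u else x)" for x
  have id: "map f t1 = t1" "map f t2 = t2"
    using gt by (auto simp: f_def intro!: map_idI)
  have q: "t1 @ u # t2 = map f (t1 @ r # t2)"
    by (simp add: id) (simp add: f_def)
  have "strict_mono_on (set (t1 @ r # t2)) f"
    using gt nless assms(2) by (auto simp: strict_mono_on_def f_def)
  then have goodq: "good (t1 @ u # t2) \<longleftrightarrow> good (t1 @ r # t2)"
    unfolding q by (rule good_map)
  have "good (s @ [u])" "good (t1 @ u # t2)" if "good (r # s @ t1 @ u # t2)"
  proof -
    have "subseq (s @ [u]) (s @ t1 @ u # t2)"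
      by (intro list_emb_append_mono subseq_drop_many) simp_all
    then show "good (s @ [u])" using good_subseq[OF that] by blast
    show "good (t1 @ u # t2)" by (rule good_subseq[OF that]) (simp add: subseq_drop_many list_emb_Cons)
  qed
  moreover have "good (r # s @ t1 @ u # t2)" if s: "good (s @ [u])" and t: "good (t1 @ u # t2)"
    unfolding good_def
  proof (rule notI, elim exE conjE)
    fix a b c d assume sub: "subseq [a, b, c, d] (r # s @ t1 @ u # t2)"
      and less: "c < a" "d < a" "a < b"
    have filt: "filter (\<lambda>x. x < r) t1 = []" "filter (\<lambda>x. x < r) t2 = []"
      "filter (\<lambda>x. x < r) s = s"
      using nless assms(1) by (simp_all add: filter_empty_conv filter_id_conv)
    have tl: "subseq [b, c, d] (s @ t1 @ u # t2)"
      using sub by (auto split: if_splits dest: subseq_Cons')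
    consider "a > r" | "a \<le> r" "b > r" | "a < r" "b < r" | "a < r" "b = r"
      using less by linarith
    then show False
    proof cases
      \<comment> \<open>Before \<open>t1\<close> there are no entries larger than \<open>r\<close>,
        so the whole subsequence lies in \<open>t1 @ u # t2\<close>.\<close>
      case 1
      then have "a \<notin> set (r # s)" using assms(1) by auto
      then have "subseq [a, b, c, d] (t1 @ u # t2)"
        using sub subseq_Cons_drop_prefix[of a "[b, c, d]" "r # s"] by simp
      then show False using t less unfolding good_def by blast
    next
      \<comment> \<open>Now \<open>c\<close> and \<open>d\<close> are both smaller than
        \<open>r\<close> and come after the large entry \<open>b\<close>, but \<open>u\<close> is
        the only small entry there.\<close>
      case 2
      then have "b \<notin> set s" using assms(1) by auto
      then have "subseq [b, c, d] (t1 @ u # t2)"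
        using tl subseq_Cons_drop_prefix[of b "[c, d]" s] by simp
      then have "subseq (filter (\<lambda>x. x < r) [b, c, d]) (filter (\<lambda>x. x < r) (t1 @ u # t2))"
        by (rule subseq_filter)
      then show False using 2 less assms(2) by (simp add: filt split: if_splits)
    next
      \<comment> \<open>All four entries are smaller than \<open>r\<close>; filtering for such
        entries leaves just \<open>s @ [u]\<close>.\<close>
      case 3
      then have "subseq (filter (\<lambda>x. x < r) [a, b, c, d]) (filter (\<lambda>x. x < r) (r # s @ t1 @ u # t2))"
        using sub by (intro subseq_filter)
      then have "subseq [a, b, c, d] (s @ [u])"
        using 3 less assms(2) by (simp add: filt)
      then show False using s less unfolding good_def by blast
    next
      \<comment> \<open>The value \<open>r\<close> occurs only at the head, whereas \<open>b\<close>
        has \<open>a\<close> before it.\<close>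
      case 4
      have "b \<in> set (s @ t1 @ u # t2)"
        using set_mono_subseq[OF tl] by simp
      then show False using 4 assms(1,2) gt by auto
    qed
  qed
  ultimately show ?thesis using goodq by blast
qed

text \<open>Small entries are peeled off the front until the first large one, \<open>x\<close>,
  appears. From there at most one small entry can follow, and \<open>butlast\<close> of the
  remaining small entries is empty.\<close>

lemma good_tail_prefix:
  fixes r :: nat
  assumes "good (r # xs)" "r \<notin> set xs"
  shows "\<exists>q. xs = butlast (filter (\<lambda>x. x < r) xs) @ q"
  using assms
proof (induction xs)
  case (Cons x xs)
  let ?s = "filter (\<lambda>x. x < r) xs"
  show ?case
  proof (cases "x < r")
    case True
    have "subseq (r # xs) (r # x # xs)" by auto
    then have "good (r # xs)" using Cons.prems(1) by (rule good_subseq[rotated])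
    then show ?thesis using Cons True by auto
  next
    case False
    \<comment> \<open>Two small entries \<open>c\<close>, \<open>d\<close> after \<open>x\<close>
      would make \<open>[r, x, c, d]\<close> a forbidden subsequence.\<close>
    have "length ?s \<le> 1"
    proof (rule ccontr)
      assume "\<not> length ?s \<le> 1"
      then obtain c d zs where cd: "?s = c # d # zs"
        by (cases ?s; cases "tl ?s") auto
      have "subseq [c, d] ?s" unfolding cd by simp
      then have "subseq [c, d] xs"
        using subseq_filter_left subseq_order.order_trans by blast
      then have "subseq [r, x, c, d] (r # x # xs)" by simp
      moreover have "c < r" "d < r"
        using arg_cong[OF cd, of set] by auto
      ultimately show False
        using Cons.prems False unfolding good_def by (metis linorder_neqE_nat list.set_intros(1))
    qed
    then have "butlast ?s = []" by (cases ?s) auto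
    then show ?thesis using False by simp
  qed
qed simp

lemma card_good_tails:
  assumes A: "finite A" "r \<notin> A" and ne: "{x \<in> A. x < r} \<noteq> {}"
  shows "card (good_tails r A) =
    card (good_perms {x \<in> A. x < r}) * card (good_perms (insert r {x \<in> A. r < x}))"
proof -
  let ?S = "{x \<in> A. x < r}" and ?L = "insert r {x \<in> A. r < x}"
  \<comment> \<open>In \<open>t\<close> the value \<open>r\<close> is a placeholder: it marks where,
    among the large entries, the last small entry is to be inserted.\<close>
  define \<phi> where "\<phi> = (\<lambda>(s, t). butlast s @ map (\<lambda>x. if x = r then last s else x) t)"
  have merge: "\<phi> (s @ [u], t1 @ r # t2) = s @ t1 @ u # t2"
    if "r \<notin> set t1" "r \<notin> set t2" for s u t1 t2
    using that by (auto simp: \<phi>_def intro!: map_idI)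
  have split: "\<exists>s' u t1 t2. s = s' @ [u] \<and> t = t1 @ r # t2 \<and> (\<forall>x\<in>set s'. x < r) \<and> u < r \<and>
      (\<forall>x\<in>set t1. r < x) \<and> (\<forall>x\<in>set t2. r < x)"
    if "s \<in> permutations_of_set ?S" "t \<in> permutations_of_set ?L" for s t
  proof -
    have s: "set s = ?S" and t: "set t = ?L" "distinct t"
      using that by (auto simp: permutations_of_set_def)
    have "s \<noteq> []" using s ne by (metis set_empty)
    then obtain s' u where s': "s = s' @ [u]" by (metis append_butlast_last_id)
    obtain t1 t2 where t': "t = t1 @ r # t2"
      using t by (metis insertI1 split_list)
    have "\<forall>x\<in>set s'. x < r" "u < r" using s unfolding s' by auto
    moreover have "\<forall>x\<in>set t1. r < x" "\<forall>x\<in>set t2. r < x"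
      using t unfolding t' by auto
    ultimately show ?thesis using s' t' by blast
  qed
  \<comment> \<open>The inverse recovers \<open>s\<close> by filtering the small entries. To recover
    \<open>t\<close> it drops the leading \<open>card ?S - 1\<close> entries, which are all of
    \<open>s\<close> but its last, and turns the one small entry left back into
    \<open>r\<close>.\<close>
  have inj: "inj_on \<phi> (permutations_of_set ?S \<times> permutations_of_set ?L)"
  proof (rule inj_on_inverseI, clarify)
    fix s t assume st: "s \<in> permutations_of_set ?S" "t \<in> permutations_of_set ?L"
    then obtain s' u t1 t2 where *: "s = s' @ [u]" "t = t1 @ r # t2" "\<forall>x\<in>set s'. x < r" "u < r"
      "\<forall>x\<in>set t1. r < x" "\<forall>x\<in>set t2. r < x" using split[OF st] by blast
    have nless: "\<forall>x\<in>set t1. \<not> x < r" "\<forall>x\<in>set t2. \<not> x < r"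
      using *(5,6) by (meson less_asym)+
    have len: "length s' = card ?S - 1"
      using length_finite_permutations_of_set[OF st(1)] *(1) by simp
    have "\<phi> (s, t) = s' @ t1 @ u # t2" using merge[of t1 t2] *(1,2,5,6) by blast
    moreover have "filter (\<lambda>x. x < r) (s' @ t1 @ u # t2) = s"
      using *(1,3,4) nless by (simp add: filter_empty_conv filter_id_conv)
    moreover have "map (\<lambda>x. if x < r then r else x) (t1 @ u # t2) = t"
      using *(2,4) nless by (simp add: map_idI)
    ultimately show "(\<lambda>xs. (filter (\<lambda>x. x < r) xs,
        map (\<lambda>x. if x < r then r else x) (drop (card ?S - 1) xs))) (\<phi> (s, t)) = (s, t)"
      using len by simp
  qed
  have "good_tails r A = \<phi> ` (good_perms ?S \<times> good_perms ?L)"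
  proof
    show "\<phi> ` (good_perms ?S \<times> good_perms ?L) \<subseteq> good_tails r A"
    proof clarify
      fix s t assume st: "s \<in> good_perms ?S" "t \<in> good_perms ?L"
      then obtain s' u t1 t2 where *: "s = s' @ [u]" "t = t1 @ r # t2" "\<forall>x\<in>set s'. x < r" "u < r"
        "\<forall>x\<in>set t1. r < x" "\<forall>x\<in>set t2. r < x"
        using split[of s t] unfolding good_perms_def by blast
      have eq: "\<phi> (s, t) = s' @ t1 @ u # t2" using merge[of t1 t2] *(1,2,5,6) by blast
      have st': "set s = ?S" "distinct s" "set t = ?L" "distinct t"
        using st by (auto simp: good_perms_def permutations_of_set_def)
      have "set t1 \<union> set t2 = set t - {r}" using *(2,5,6) by auto
      also have "\<dots> = {x \<in> A. r < x}" unfolding st' by auto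
      finally have "set (s' @ t1 @ u # t2) = ?S \<union> {x \<in> A. r < x}"
        using st'(1) unfolding *(1) by auto
      also have "\<dots> = {x \<in> A. x \<noteq> r}" by auto
      also have "\<dots> = A" using A(2) by auto
      finally have "set (\<phi> (s, t)) = A" unfolding eq .
      moreover have "distinct (\<phi> (s, t))"
      proof -
        have "set (s' @ [u]) \<inter> (set t1 \<union> set t2) = {}"
          using *(3-6) by (auto dest: less_asym)
        then show ?thesis
          using st'(2,4) unfolding eq unfolding *(1,2) by auto
      qed
      moreover have "good (r # \<phi> (s, t))"
        unfolding eq using good_merge_iff[of s' r u t1 t2] st * by (auto simp: good_perms_def)
      ultimately show "\<phi> (s, t) \<in> good_tails r A"
        by (simp add: good_tails_def permutations_of_set_def)
    qed
    show "good_tails r A \<subseteq> \<phi> ` (good_perms ?S \<times> good_perms ?L)"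
    proof
      fix xs assume "xs \<in> good_tails r A"
      then have xs: "set xs = A" "distinct xs" "good (r # xs)"
        by (auto simp: good_tails_def permutations_of_set_def)
      let ?s = "filter (\<lambda>x. x < r) xs"
      have "set ?s = ?S" "distinct ?s" using xs by auto
      then have "?s \<noteq> []" using ne by force
      define s u where "s = butlast ?s" and "u = last ?s"
      have s: "?s = s @ [u]" using \<open>?s \<noteq> []\<close> by (simp add: s_def u_def)
      obtain q where q: "xs = s @ q"
        using good_tail_prefix[OF xs(3)] A(2) xs(1) s_def by auto
      have less: "\<forall>x\<in>set s. x < r" "u < r"
        using arg_cong[OF s, of set] by auto
      \<comment> \<open>The prefix \<open>s\<close> has used up all small entries but the last, so
        \<open>q\<close> is a shuffle of \<open>u\<close> with the large ones.\<close>
      have "filter (\<lambda>x. x < r) q = [u]"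
        using s less unfolding q by simp
      then obtain t1 t2 where t: "q = t1 @ u # t2" "\<forall>x\<in>set t1. \<not> x < r" "\<forall>x\<in>set t2. \<not> x < r"
        by (auto simp: filter_eq_Cons_iff empty_filter_conv)
      have "r \<notin> set xs" using A(2) xs(1) by simp
      then have "r \<notin> set t1" "r \<notin> set t2" unfolding q t(1) by simp_all
      then have gr: "\<forall>x\<in>set t1. r < x" "\<forall>x\<in>set t2. r < x"
        using t(2,3) by (metis linorder_neqE_nat)+
      have "good (s @ [u])" "good (t1 @ r # t2)"
        using xs(3) good_merge_iff[of s r u t1 t2] less gr unfolding q t(1) by auto
      moreover have "set (t1 @ r # t2) = ?L"
      proof -
        have "{x \<in> A. r < x} = set (filter (\<lambda>x. r < x) xs)" using xs(1) by auto
        also have "\<dots> = set t1 \<union> set t2"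
          using gr less unfolding q t(1) by auto
        finally show ?thesis by auto
      qed
      moreover have "distinct (t1 @ r # t2)"
        using \<open>r \<notin> set t1\<close> \<open>r \<notin> set t2\<close> xs(2) unfolding q t(1) by auto
      ultimately have "(s @ [u], t1 @ r # t2) \<in> good_perms ?S \<times> good_perms ?L"
        using \<open>set ?s = ?S\<close> \<open>distinct ?s\<close> unfolding s
        by (simp add: good_perms_def permutations_of_set_def)
      moreover have "\<phi> (s @ [u], t1 @ r # t2) = xs"
        unfolding q t(1) by (rule merge) fact+
      ultimately show "xs \<in> \<phi> ` (good_perms ?S \<times> good_perms ?L)" by (rule rev_image_eqI[OF _ sym])
    qed
  qed
  moreover have "inj_on \<phi> (good_perms ?S \<times> good_perms ?L)"
    using inj by (rule inj_on_subset) (auto simp: good_perms_def)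
  ultimately show ?thesis by (simp add: card_image card_cartesian_product)
qed

text \<open>For \<open>r = 1\<close> no small entry exists and the first entry imposes no
  restriction. Otherwise the factors belong to \<open>{1..<r}\<close> and \<open>{r..n}\<close>; the
  latter has \<open>Suc (n - r)\<close> elements because the placeholder \<open>r\<close>
  counts.\<close>

lemma card_good_tails_interval:
  assumes "1 \<le> r" "r \<le> n"
  shows "card (good_tails r ({1..n} - {r})) = (if r = 1 then card (good_perms {..<n - 1})
    else card (good_perms {..<r - 1}) * card (good_perms {..<Suc (n - r)}))"
proof (cases "r = 1")
  case True
  have "card ({1..n} - {r}) = n - 1" using assms by simp
  moreover have "good_tails r ({1..n} - {r}) = good_perms ({1..n} - {r})"
    using True by (intro good_tails_least) auto
  ultimately show ?thesis
    using True card_good_perms[of "{1..n} - {r}"] by simp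
next
  case False
  have small: "{x \<in> {1..n} - {r}. x < r} = {1..<r}"
    and large: "insert r {x \<in> {1..n} - {r}. r < x} = {r..n}"
    using assms by auto
  have "card (good_tails r ({1..n} - {r})) = card (good_perms {1..<r}) * card (good_perms {r..n})"
    using card_good_tails[of "{1..n} - {r}" r] assms False unfolding small large by auto
  then show ?thesis
    using False assms card_good_perms[of "{1..<r}"] card_good_perms[of "{r..n}"]
    by (simp add: Suc_diff_le)
qed

section \<open>Summation over the first entry\<close>

lemma good_perms_Cons:
  assumes "A \<noteq> {}"
  shows "good_perms A = (\<Union>r\<in>A. (#) r ` good_tails r (A - {r}))"
  unfolding good_perms_def good_tails_def permutations_of_set_nonempty[OF assms] by auto

lemma card_good_perms_Cons:
  assumes "finite A" "A \<noteq> {}"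
  shows "card (good_perms A) = (\<Sum>r\<in>A. card (good_tails r (A - {r})))"
proof -
  have "card (good_perms A) = (\<Sum>r\<in>A. card ((#) r ` good_tails r (A - {r})))"
    unfolding good_perms_Cons[OF assms(2)]
    using assms(1) by (intro card_UN_disjoint) (auto simp: good_tails_def)
  then show ?thesis by (simp add: card_image)
qed

text \<open>Both sequences start with 1 and satisfy the same recurrence: first entry 1 corresponds
  to a diagonal first step, and first entry \<open>i + 2\<close> to a first excursion of index
  \<open>i\<close>.\<close>

lemma card_good_perms_eq_large_schroeder: "card (good_perms {..<Suc k}) = large_schroeder k"
proof (induction k rule: less_induct)
  case (less k)
  show ?case
  proof (cases k)
    case 0
    have "good_perms {..<Suc 0} = {[0]}"
      by (auto simp: good_perms_def good_def lessThan_Suc)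
    then show ?thesis using 0 by (simp add: large_schroeder_0)
  next
    case (Suc j)
    let ?a = "\<lambda>m. card (good_perms {..<m})"
    let ?n = "Suc (Suc j)"
    have "?a ?n = (\<Sum>r\<in>{1..?n}. card (good_tails r ({1..?n} - {r})))"
      using card_good_perms[of "{1..?n}"] card_good_perms_Cons[of "{1..?n}"] by simp
    also have "\<dots> = (\<Sum>r\<in>{1..?n}. if r = 1 then ?a (?n - 1) else ?a (r - 1) * ?a (Suc (?n - r)))"
      by (intro sum.cong refl card_good_tails_interval) auto
    also have "{1..?n} = insert 1 {2..?n}" by auto
    also have "(\<Sum>r\<in>insert 1 {2..?n}. if r = 1 then ?a (?n - 1) else ?a (r - 1) * ?a (Suc (?n - r)))
        = ?a (Suc j) + (\<Sum>r\<in>{2..?n}. ?a (r - 1) * ?a (Suc (?n - r)))"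
      by (subst sum.insert) (auto intro!: sum.cong)
    also have "(\<Sum>r\<in>{2..?n}. ?a (r - 1) * ?a (Suc (?n - r))) =
        (\<Sum>i\<le>j. large_schroeder i * large_schroeder (j - i))"
    \<comment> \<open>With \<open>i = r - 2\<close>, the set sizes \<open>r - 1\<close> and
      \<open>Suc (?n - r)\<close> are \<open>Suc i\<close> and \<open>Suc (j - i)\<close>, so the
      induction hypothesis applies to \<open>i\<close> and \<open>j - i\<close>.\<close>
    proof (rule sum.reindex_bij_witness[of _ "\<lambda>i. i + 2" "\<lambda>r. r - 2"])
      fix r assume r: "r \<in> {2..?n}"
      then have "r - 1 = Suc (r - 2)" "Suc (?n - r) = Suc (j - (r - 2))" by auto
      moreover have "r - 2 < k" "j - (r - 2) < k" using r Suc by auto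
      ultimately show "large_schroeder (r - 2) * large_schroeder (j - (r - 2)) =
          ?a (r - 1) * ?a (Suc (?n - r))"
        using less.IH by metis
    qed auto
    also have "?a (Suc j) = large_schroeder j" using less.IH Suc by simp
    finally show ?thesis using Suc large_schroeder_Suc by simp
  qed
qed

lemma card_avoiders_from:
  assumes "1 \<le> r" "r \<le> n"
  shows "card (avoiders_from n r {[3, 4, 1, 2], [3, 4, 2, 1]}) = card (good_tails r ({1..n} - {r}))"
proof -
  have "avoiders_from n r {[3, 4, 1, 2], [3, 4, 2, 1]} = {\<tau> \<in> good_perms {1..n}. \<tau> ! 0 = r}"
    unfolding avoiders_from_def good_perms_def
    using avoids_both_iff_good by (auto dest: permutations_of_setD)
  also have "\<dots> = (#) r ` good_tails r ({1..n} - {r})"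
    using assms by (subst good_perms_Cons) auto
  finally show ?thesis by (simp add: card_image)
qed

theorem theorem6p2:
  shows "(\<forall>n r :: nat. n \<ge> 2 \<and> r \<in> {1, 2, n} \<longrightarrow>
            card (avoiders_from n r {[3, 4, 1, 2], [3, 4, 2, 1]}) = large_schroeder (n - 2)) \<and>
         (\<forall>n r :: nat. n \<ge> 4 \<and> 2 < r \<and> r < n \<longrightarrow>
            card (avoiders_from n r {[3, 4, 1, 2], [3, 4, 2, 1]}) =
              large_schroeder (r - 2) * large_schroeder (n - r))"
proof -
  have a: "card (good_perms {..<m}) = large_schroeder (m - 1)" if "m \<ge> 1" for m
    using card_good_perms_eq_large_schroeder[of "m - 1"] that by simp
  have count: "card (avoiders_from n r {[3, 4, 1, 2], [3, 4, 2, 1]}) =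
      (if r = 1 then large_schroeder (n - 2) else large_schroeder (r - 2) * large_schroeder (n - r))"
    if "n \<ge> 2" "1 \<le> r" "r \<le> n" for n r
    unfolding card_avoiders_from[OF that(2,3)] card_good_tails_interval[OF that(2,3)]
    using that by (simp add: a numeral_2_eq_2)
  show ?thesis
    \<comment> \<open>For \<open>r = 2\<close> and for \<open>r = n\<close> one of the two factors
      is \<open>large_schroeder 0\<close>, which is 1, so these cases agree with
      \<open>r = 1\<close>.\<close>
    using count by (auto simp: large_schroeder_0)
qed

end
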